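(* Let $F$ be a field and $V_n$ an $n$-dimensional vector space over $F$. Let $S$ denote one of the semigroups $\mathrm{End}(V_n)$ or $\mathrm{PEnd}(V_n)$, and let $\varphi,\psi\in S$. Then $\varphi$ and $\psi$ are $S$-conjugate if and only if $\overline{\varphi e_{\varphi}}$ and $\overline{\psi e_{\psi}}$ are $\mathrm{GL}(V_n)$-conjugate.
   Context: $\mathrm{End}(V_n)$ is the semigroup of all linear endomorphisms of $V_n$; $\mathrm{PEnd}(V_n)$ is the semigroup of all partial endomorphisms, i.e. linear maps from a subspace of $V_n$ (the domain) into $V_n$, under composition of partial maps. In both semigroups every element has a power lying in a subgroup. For $\varphi\in S$, $e_\varphi$ denotes the identity element of the group $H_{\varphi^t}$ (the $\mathcal{H}$-class of $\varphi^t$ in $S$ for Green's relation $\mathcal{H}$), where $t\ge 1$ is such that $H_{\varphi^t}$ is a group; this does not depend on $t$. The element $\varphi e_\varphi$ lies in a subgroup of $S$. For an element $\pi\in S$ lying in a subgroup of $S$, $\overline{\pi}$ denotes the restriction of $\pi$ to its range $\mathrm{ran}\,\pi$; it is an automorphism of the subspace $\mathrm{ran}\,\pi$ and hence an element of $\mathrm{PAut}(V_n)$, the semigroup of all linear isomorphisms between subspaces of $V_n$ under composition of partial maps. Elements $a,b\in \mathrm{PAut}(V_n)$ are $\mathrm{GL}(V_n)$-conjugate if $a=g^{-1}bg$ for some $g\in\mathrm{GL}(V_n)$. In a semigroup $S$ write $a\sim_p b$ if $a=xy$, $b=yx$ for some $x,y\in S$; $a,b$ are $S$-conjugate if they are related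 by the transitive closure of $\sim_p$. *)

theory Defs
  imports Complex_Main "HOL-Algebra.Coset"
begin

section \<open>Semigroup notions\<close>

text \<open>
  A semigroup is given by the carrier and the multiplication of a \<^typ>\<open>'a monoid\<close> record.
  In \<^term>\<open>insert a (carrier S #>\<^bsub>S\<^esub> a)\<close> the inserted element accounts for the adjoined
  identity, i.e. the set is the principal left ideal generated by \<^term>\<open>a\<close> in a semigroup
  that need not have an identity.
\<close>

definition green_L :: "('a, 'b) monoid_scheme \<Rightarrow> 'a \<Rightarrow> 'a \<Rightarrow> bool" where
  "green_L S a b \<longleftrightarrow> insert a (carrier S #>\<^bsub>S\<^esub> a) = insert b (carrier S #>\<^bsub>S\<^esub> b)"

definition green_R :: "('a, 'b) monoid_scheme \<Rightarrow> 'a \<Rightarrow> 'a \<Rightarrow> bool" where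
  "green_R S a b \<longleftrightarrow> insert a (a <#\<^bsub>S\<^esub> carrier S) = insert b (b <#\<^bsub>S\<^esub> carrier S)"

definition H_class :: "('a, 'b) monoid_scheme \<Rightarrow> 'a \<Rightarrow> 'a set" where
  "H_class S a = {b \<in> carrier S. green_L S a b \<and> green_R S a b}"

text \<open>
  The identity of the group \<open>H\<close>-class containing a positive power of \<^term>\<open>a\<close>. The identity of
  that group is in general not the identity of \<^term>\<open>S\<close>, hence the update of the field \<open>one\<close>.
\<close>

definition power_idem :: "('a, 'b) monoid_scheme \<Rightarrow> 'a \<Rightarrow> 'a" where
  "power_idem S a =
     (THE e. \<exists>t::nat. t \<ge> 1 \<and> group (S\<lparr>carrier := H_class S (a [^]\<^bsub>S\<^esub> t), one := e\<rparr>))"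

definition p_related :: "('a, 'b) monoid_scheme \<Rightarrow> 'a \<Rightarrow> 'a \<Rightarrow> bool" where
  "p_related S a b \<longleftrightarrow>
     (\<exists>x\<in>carrier S. \<exists>y\<in>carrier S. a = x \<otimes>\<^bsub>S\<^esub> y \<and> b = y \<otimes>\<^bsub>S\<^esub> x)"

definition semigroup_conjugate :: "('a, 'b) monoid_scheme \<Rightarrow> 'a \<Rightarrow> 'a \<Rightarrow> bool" where
  "semigroup_conjugate S = (p_related S)\<^sup>+\<^sup>+"


section \<open>Partial linear maps\<close>

text \<open>
  Maps act on the right: \<^term>\<open>pcomp f g\<close> applies \<^term>\<open>f\<close> first, on the largest possible domain.
\<close>

definition pcomp :: "('v \<rightharpoonup> 'v) \<Rightarrow> ('v \<rightharpoonup> 'v) \<Rightarrow> ('v \<rightharpoonup> 'v)" where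
  "pcomp f g = g \<circ>\<^sub>m f"

definition partial_linear :: "('f::field \<Rightarrow> 'v::ab_group_add \<Rightarrow> 'v) \<Rightarrow> ('v \<rightharpoonup> 'v) \<Rightarrow> bool" where
  "partial_linear scale f \<longleftrightarrow>
     module.subspace scale (dom f) \<and>
     (\<forall>x\<in>dom f. \<forall>y\<in>dom f. the (f (x + y)) = the (f x) + the (f y)) \<and>
     (\<forall>c. \<forall>x\<in>dom f. the (f (scale c x)) = scale c (the (f x)))"

definition PEnd :: "('f::field \<Rightarrow> 'v::ab_group_add \<Rightarrow> 'v) \<Rightarrow> ('v \<rightharpoonup> 'v) monoid" where
  "PEnd scale = \<lparr>carrier = {f. partial_linear scale f}, mult = pcomp, one = Some\<rparr>"

text \<open>Endomorphisms are represented as partial maps with domain \<^term>\<open>UNIV\<close>.\<close>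

definition End :: "('f::field \<Rightarrow> 'v::ab_group_add \<Rightarrow> 'v) \<Rightarrow> ('v \<rightharpoonup> 'v) monoid" where
  "End scale =
     \<lparr>carrier = {Some \<circ> f |f. Vector_Spaces.linear scale scale f}, mult = pcomp, one = Some\<rparr>"

definition PAut :: "('f::field \<Rightarrow> 'v::ab_group_add \<Rightarrow> 'v) \<Rightarrow> ('v \<rightharpoonup> 'v) set" where
  "PAut scale = {f. partial_linear scale f \<and> inj_on f (dom f) \<and> module.subspace scale (ran f)}"

definition GL :: "('f::field \<Rightarrow> 'v::ab_group_add \<Rightarrow> 'v) \<Rightarrow> ('v \<Rightarrow> 'v) set" where
  "GL scale = {g. Vector_Spaces.linear scale scale g \<and> bij g}"

definition GL_conjugate ::
    "('f::field \<Rightarrow> 'v::ab_group_add \<Rightarrow> 'v) \<Rightarrow> ('v \<rightharpoonup> 'v) \<Rightarrow> ('v \<rightharpoonup> 'v) \<Rightarrow> bool" where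
  "GL_conjugate scale a b \<longleftrightarrow>
     a \<in> PAut scale \<and> b \<in> PAut scale \<and>
     (\<exists>g\<in>GL scale. a = pcomp (pcomp (Some \<circ> inv_into UNIV g) b) (Some \<circ> g))"

definition ran_restrict :: "('v \<rightharpoonup> 'v) \<Rightarrow> ('v \<rightharpoonup> 'v)" where
  "ran_restrict f = f |` ran f"

end

theory Submission
  imports Defs
begin

text \<open>
  Let \<open>core f\<close> be the largest set \<open>U\<close> with \<open>U \<subseteq> f(U)\<close>. In finite dimension it is a subspace on which
  \<open>f\<close> is an automorphism, and it is the eventual value of the decreasing chain
  \<open>ran f \<supseteq> ran f\<^sup>2 \<supseteq> \<dots>\<close>; for a total map it is the invertible summand of the Fitting decomposition.

  The map \<open>\<phi> e\<^sub>\<phi>\<close>, restricted to its range, is just \<open>\<phi>\<close> restricted to \<open>core \<phi>\<close>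
  (\<open>ran_restrict_power_idem\<close>). Indeed, an \<open>H\<close>-class is a group with identity \<open>e\<close> exactly if it
  consists of the units of the local monoid \<open>e S e\<close>, and these units determine \<open>e\<close>. Now let
  \<open>p = \<phi>\<^sup>t\<close> have range \<open>core \<phi>\<close>, and let \<open>r\<close> be a linear map inverting \<open>p\<close> on the core. Then \<open>p\<close>
  followed by \<open>r\<close> serves as \<open>e\<close>: it maps onto the core and fixes the core pointwise.
  So the claim becomes that \<open>\<phi>\<close> and \<open>\<psi>\<close> are conjugate in the semigroup if and only if their
  restrictions to their cores are similar.

  If \<open>\<phi> = x y\<close> and \<open>\<psi> = y x\<close>, then \<open>x\<close> maps \<open>core \<phi>\<close> into \<open>core \<psi>\<close> and \<open>y\<close> maps it back, onto
  \<open>core \<phi>\<close>. Comparing dimensions, \<open>x\<close> restricts to an isomorphism of the cores that intertwines \<open>\<phi>\<close>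
  and \<open>\<psi>\<close>, and it extends to an element of the general linear group
  (\<open>swap_imp_GL_conjugate\<close>).

  Conversely, every \<open>\<phi>\<close> is semigroup conjugate to \<open>P \<phi>\<close>, for any linear projection \<open>P\<close> onto its core:
  if \<open>Q\<close> projects onto \<open>ran \<phi>\<close>, then \<open>\<phi> = \<phi> Q\<close> may be replaced by \<open>Q \<phi>\<close>, which has the same core but
  the smaller range \<open>ran \<phi>\<^sup>2\<close>, until the range has shrunk to the core
  (\<open>semigroup_conjugate_collapse\<close>). The map \<open>P \<phi>\<close> depends only on \<open>P\<close> and on the action of \<open>\<phi>\<close> on its
  core. So if \<open>g\<close> intertwines the actions on the cores, projections that correspond under \<open>g\<close> turn
  \<open>\<phi>\<close> and \<open>\<psi>\<close> into maps conjugate by \<open>g\<close>.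
\<close>

section \<open>Group H-classes of a monoid\<close>

text \<open>
  Equivalently, \<open>p\<close> is a unit of the local monoid \<open>e S e\<close>. The inverse \<open>q\<close> is allowed to lie outside
  \<open>e S e\<close>, which makes the property easier to verify; \<open>q e\<close> is then an inverse inside.
\<close>

definition local_unit :: "('a, 'b) monoid_scheme \<Rightarrow> 'a \<Rightarrow> 'a \<Rightarrow> bool" where
  "local_unit S e p \<longleftrightarrow> e \<in> carrier S \<and> p \<in> carrier S \<and> e \<otimes>\<^bsub>S\<^esub> p = p \<and> p \<otimes>\<^bsub>S\<^esub> e = p \<and>
     (\<exists>q\<in>carrier S. p \<otimes>\<^bsub>S\<^esub> q = e \<and> q \<otimes>\<^bsub>S\<^esub> p = e)"

context monoid begin

lemma local_unit_idem:
  assumes "local_unit G e p"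
  shows "e \<otimes> e = e" "local_unit G e e"
proof -
  from assms obtain q where q: "e \<in> carrier G" "p \<in> carrier G" "q \<in> carrier G"
      "e \<otimes> p = p" "p \<otimes> q = e"
    unfolding local_unit_def by blast
  then show "e \<otimes> e = e" by (metis m_assoc)
  with q show "local_unit G e e" unfolding local_unit_def by auto
qed

lemma local_unit_mult:
  assumes "local_unit G e a" "local_unit G e b"
  shows "local_unit G e (a \<otimes> b)"
proof -
  from assms(1) obtain a' where a: "e \<in> carrier G" "a \<in> carrier G" "a' \<in> carrier G"
      "e \<otimes> a = a" "a \<otimes> e = a" "a \<otimes> a' = e" "a' \<otimes> a = e"
    unfolding local_unit_def by blast
  from assms(2) obtain b' where b: "b \<in> carrier G" "b' \<in> carrier G"
      "e \<otimes> b = b" "b \<otimes> e = b" "b \<otimes> b' = e" "b' \<otimes> b = e"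
    unfolding local_unit_def by blast
  have "a \<otimes> b \<otimes> (b' \<otimes> a') = a \<otimes> (b \<otimes> b') \<otimes> a'"
    using a b by (metis m_assoc m_closed)
  also have "\<dots> = e" using a b by simp
  finally have 1: "a \<otimes> b \<otimes> (b' \<otimes> a') = e" .
  have "b' \<otimes> a' \<otimes> (a \<otimes> b) = b' \<otimes> ((a' \<otimes> a) \<otimes> b)"
    using a b by (metis m_assoc m_closed)
  also have "\<dots> = e" using a b by simp
  finally have 2: "b' \<otimes> a' \<otimes> (a \<otimes> b) = e" .
  have "e \<otimes> (a \<otimes> b) = a \<otimes> b" using a b by (simp flip: m_assoc)
  moreover have "a \<otimes> b \<otimes> e = a \<otimes> b" using a b by (simp add: m_assoc)
  ultimately show ?thesis unfolding local_unit_def using 1 2 a b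
    by (intro conjI bexI[of _ "b' \<otimes> a'"]) auto
qed

lemma local_unit_nat_pow:
  assumes "local_unit G e p" "n \<ge> 1"
  shows "local_unit G e (p [^] (n::nat))"
  using assms(2)
proof (induction n rule: nat_induct_at_least)
  case base
  have "p \<in> carrier G" using assms(1) by (simp add: local_unit_def)
  then show ?case using assms(1) by simp
next
  case (Suc n)
  then show ?case using local_unit_mult[OF _ assms(1)] by simp
qed

text \<open>
  Both identities can be cancelled against \<open>w\<close>: \<open>e\<close> is a right multiple of \<open>w\<close>, hence \<open>f e = e\<close>, and
  \<open>f\<close> is a left multiple of \<open>w\<close>, hence \<open>f e = f\<close>.
\<close>

lemma local_unit_unique:
  assumes "local_unit G e w" "local_unit G f w"
  shows "e = f"
proof -
  from assms(1) obtain q where q: "e \<in> carrier G" "w \<in> carrier G" "q \<in> carrier G"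
      "w \<otimes> e = w" "w \<otimes> q = e"
    unfolding local_unit_def by blast
  from assms(2) obtain r where r: "f \<in> carrier G" "r \<in> carrier G"
      "f \<otimes> w = w" "r \<otimes> w = f"
    unfolding local_unit_def by blast
  have "e = f \<otimes> e" using q r by (metis m_assoc)
  moreover have "f = f \<otimes> e" using q r by (metis m_assoc)
  ultimately show ?thesis by simp
qed

lemma green_R_iff:
  assumes "a \<in> carrier G" "b \<in> carrier G"
  shows "green_R G a b \<longleftrightarrow> (\<exists>u\<in>carrier G. b = a \<otimes> u) \<and> (\<exists>v\<in>carrier G. a = b \<otimes> v)"
proof -
  have ideal: "insert x (x <# carrier G) = {x \<otimes> u | u. u \<in> carrier G}" if "x \<in> carrier G" for x
    using that r_one[OF that] one_closed unfolding l_coset_def by (auto, metis)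
  have "{a \<otimes> u | u. u \<in> carrier G} \<subseteq> {b \<otimes> u | u. u \<in> carrier G} \<longleftrightarrow> (\<exists>v\<in>carrier G. a = b \<otimes> v)"
    if "a \<in> carrier G" "b \<in> carrier G" for a b
  proof
    assume "{a \<otimes> u | u. u \<in> carrier G} \<subseteq> {b \<otimes> u | u. u \<in> carrier G}"
    moreover have "a \<in> {a \<otimes> u | u. u \<in> carrier G}"
      using r_one[OF that(1)] one_closed by (metis (mono_tags, lifting) mem_Collect_eq)
    ultimately show "\<exists>v\<in>carrier G. a = b \<otimes> v" by auto
  next
    assume "\<exists>v\<in>carrier G. a = b \<otimes> v"
    then obtain v where v: "v \<in> carrier G" "a = b \<otimes> v" by blast
    have "a \<otimes> u = b \<otimes> (v \<otimes> u)" if "u \<in> carrier G" for u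
      using v that \<open>b \<in> carrier G\<close> by (simp add: m_assoc)
    then show "{a \<otimes> u | u. u \<in> carrier G} \<subseteq> {b \<otimes> u | u. u \<in> carrier G}"
      using v(1) by blast
  qed
  from this[of a b] this[of b a] show ?thesis
    unfolding green_R_def ideal[OF assms(1)] ideal[OF assms(2)] using assms by auto
qed

lemma green_L_iff:
  assumes "a \<in> carrier G" "b \<in> carrier G"
  shows "green_L G a b \<longleftrightarrow> (\<exists>u\<in>carrier G. b = u \<otimes> a) \<and> (\<exists>v\<in>carrier G. a = v \<otimes> b)"
proof -
  have ideal: "insert x (carrier G #> x) = {u \<otimes> x | u. u \<in> carrier G}" if "x \<in> carrier G" for x
    using that l_one[OF that] one_closed unfolding r_coset_def by (auto, metis)
  have "{u \<otimes> a | u. u \<in> carrier G} \<subseteq> {u \<otimes> b | u. u \<in> carrier G} \<longleftrightarrow> (\<exists>v\<in>carrier G. a = v \<otimes> b)"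
    if "a \<in> carrier G" "b \<in> carrier G" for a b
  proof
    assume "{u \<otimes> a | u. u \<in> carrier G} \<subseteq> {u \<otimes> b | u. u \<in> carrier G}"
    moreover have "a \<in> {u \<otimes> a | u. u \<in> carrier G}"
      using l_one[OF that(1)] one_closed by (metis (mono_tags, lifting) mem_Collect_eq)
    ultimately show "\<exists>v\<in>carrier G. a = v \<otimes> b" by auto
  next
    assume "\<exists>v\<in>carrier G. a = v \<otimes> b"
    then obtain v where v: "v \<in> carrier G" "a = v \<otimes> b" by blast
    have "u \<otimes> a = (u \<otimes> v) \<otimes> b" if "u \<in> carrier G" for u
      using v that \<open>b \<in> carrier G\<close> by (simp add: m_assoc)
    then show "{u \<otimes> a | u. u \<in> carrier G} \<subseteq> {u \<otimes> b | u. u \<in> carrier G}"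
      using v(1) by blast
  qed
  from this[of a b] this[of b a] show ?thesis
    unfolding green_L_def ideal[OF assms(1)] ideal[OF assms(2)] using assms by auto
qed

text \<open>
  Green's theorem on group \<open>H\<close>-classes. Being \<open>H\<close>-related to \<open>p\<close> is the same as being \<open>H\<close>-related
  to \<open>e\<close>, and this says that \<open>b\<close> lies in \<open>e S \<inter> S e\<close> and has one-sided inverses with respect to \<open>e\<close>.
\<close>

lemma H_class_eq_local_units:
  assumes "local_unit G e p"
  shows "H_class G p = {b. local_unit G e b}"
proof (intro Set.set_eqI iffI)
  from assms obtain q where q: "e \<in> carrier G" "p \<in> carrier G" "q \<in> carrier G"
      "e \<otimes> p = p" "p \<otimes> e = p" "p \<otimes> q = e" "q \<otimes> p = e"
    unfolding local_unit_def by blast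
  note ee = local_unit_idem(1)[OF assms]
  {
    fix b assume "b \<in> H_class G p"
    then have b: "b \<in> carrier G" and L: "green_L G p b" and R: "green_R G p b"
      unfolding H_class_def by auto
    from R obtain u v where uv: "u \<in> carrier G" "v \<in> carrier G" "b = p \<otimes> u" "p = b \<otimes> v"
      unfolding green_R_iff[OF q(2) b] by blast
    from L obtain u' v' where uv': "u' \<in> carrier G" "v' \<in> carrier G" "b = u' \<otimes> p" "p = v' \<otimes> b"
      unfolding green_L_iff[OF q(2) b] by blast
    have eb: "e \<otimes> b = b" unfolding uv(3) using m_assoc[OF q(1,2) uv(1)] q(4) by simp
    have be: "b \<otimes> e = b" unfolding uv'(3) using m_assoc[OF uv'(1) q(2,1)] q(5) by simp
    define x where "x = v \<otimes> q"
    define y where "y = q \<otimes> v'"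
    have xy: "x \<in> carrier G" "y \<in> carrier G" using q(3) uv(2) uv'(2) by (simp_all add: x_def y_def)
    have bx: "b \<otimes> x = e" unfolding x_def using m_assoc[OF b uv(2) q(3)] q(6) by (simp flip: uv(4))
    have yb: "y \<otimes> b = e" unfolding y_def using m_assoc[OF q(3) uv'(2) b] q(7) by (simp flip: uv'(4))
    have "b \<otimes> (e \<otimes> x \<otimes> e) = b \<otimes> e \<otimes> x \<otimes> e" using b q(1) xy by (simp add: m_assoc)
    then have 1: "b \<otimes> (e \<otimes> x \<otimes> e) = e" by (simp add: be bx ee)
    \<comment> \<open>The right inverse is also a left inverse: replace the left \<open>e\<close> by \<open>y \<otimes> b\<close>.\<close>
    have "e \<otimes> x \<otimes> e \<otimes> b = e \<otimes> x \<otimes> b" using b q(1) xy by (simp add: m_assoc eb)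
    also have "\<dots> = y \<otimes> (b \<otimes> x) \<otimes> b" using m_assoc[OF xy(2) b xy(1)] by (simp add: yb)
    also have "y \<otimes> (b \<otimes> x) \<otimes> b = y \<otimes> b" using xy b q(1) by (simp only: bx m_assoc eb)
    finally have 2: "e \<otimes> x \<otimes> e \<otimes> b = e" by (simp add: yb)
    show "b \<in> {b. local_unit G e b}"
      unfolding local_unit_def mem_Collect_eq
      by (intro conjI bexI[of _ "e \<otimes> x \<otimes> e"] b eb be 1 2 m_closed xy q(1))
  next
    fix b assume "b \<in> {b. local_unit G e b}"
    then obtain r where r: "b \<in> carrier G" "r \<in> carrier G"
      "e \<otimes> b = b" "b \<otimes> e = b" "b \<otimes> r = e" "r \<otimes> b = e"
      unfolding local_unit_def by blast
    have "b = p \<otimes> (q \<otimes> b)" using m_assoc[OF q(2,3) r(1)] q(6) r(3) by simp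
    moreover have "p = b \<otimes> (r \<otimes> p)" using m_assoc[OF r(1,2) q(2)] q(4) r(5) by simp
    moreover have "b = (b \<otimes> q) \<otimes> p" using m_assoc[OF r(1) q(3,2)] q(7) r(4) by simp
    moreover have "p = (p \<otimes> r) \<otimes> b" using m_assoc[OF q(2) r(2,1)] q(5) r(6) by simp
    moreover have "q \<otimes> b \<in> carrier G" "r \<otimes> p \<in> carrier G" "b \<otimes> q \<in> carrier G" "p \<otimes> r \<in> carrier G"
      using q r by auto
    ultimately have "green_R G p b" "green_L G p b"
      unfolding green_R_iff[OF q(2) r(1)] green_L_iff[OF q(2) r(1)] by blast+
    then show "b \<in> H_class G p" unfolding H_class_def using r by simp
  }
qed

lemma group_H_class_iff_local_unit:
  assumes "p \<in> carrier G"
  shows "group (G\<lparr>carrier := H_class G p, one := e\<rparr>) \<longleftrightarrow> local_unit G e p"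
proof
  assume "group (G\<lparr>carrier := H_class G p, one := e\<rparr>)"
  then interpret H: group "G\<lparr>carrier := H_class G p, one := e\<rparr>" .
  have p: "p \<in> H_class G p" using assms by (simp add: H_class_def green_L_def green_R_def)
  have "H_class G p \<subseteq> carrier G" by (auto simp: H_class_def)
  moreover have "e \<in> H_class G p" "e \<otimes> p = p" "p \<otimes> e = p"
    using H.one_closed H.l_one[of p] H.r_one[of p] p by auto
  moreover obtain q where "q \<in> H_class G p" "p \<otimes> q = e" "q \<otimes> p = e"
    using H.inv_closed[of p] H.r_inv[of p] H.l_inv[of p] p by auto
  ultimately show "local_unit G e p" unfolding local_unit_def using assms by blast
next
  assume u: "local_unit G e p"
  show "group (G\<lparr>carrier := H_class G p, one := e\<rparr>)"
    unfolding H_class_eq_local_units[OF u]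
  proof (rule groupI; simp)
    show "local_unit G e e" by (rule local_unit_idem(2)[OF u])
    show "local_unit G e (x \<otimes> y)" if "local_unit G e x" "local_unit G e y" for x y
      using local_unit_mult that by blast
    show "x \<otimes> y \<otimes> z = x \<otimes> (y \<otimes> z)"
      if "local_unit G e x" "local_unit G e y" "local_unit G e z" for x y z
      using that by (simp add: local_unit_def m_assoc)
    show "e \<otimes> x = x" if "local_unit G e x" for x using that by (simp add: local_unit_def)
    show "\<exists>y. local_unit G e y \<and> y \<otimes> x = e" if x: "local_unit G e x" for x
    proof -
      from x obtain q where q: "e \<in> carrier G" "x \<in> carrier G" "q \<in> carrier G"
        "e \<otimes> x = x" "x \<otimes> e = x" "x \<otimes> q = e" "q \<otimes> x = e"
        unfolding local_unit_def by blast
      note ee = local_unit_idem(1)[OF x]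
      have eq: "e \<otimes> q = q \<otimes> e" using m_assoc[OF q(3,2,3)] q(6,7) by simp
      have "local_unit G e (q \<otimes> e)"
        unfolding local_unit_def
      proof (intro conjI bexI)
        show "e \<otimes> (q \<otimes> e) = q \<otimes> e" using m_assoc[OF q(1,3,1)] m_assoc[OF q(3,1,1)] ee eq by simp
        show "q \<otimes> e \<otimes> e = q \<otimes> e" using m_assoc[OF q(3,1,1)] ee by simp
        show "q \<otimes> e \<otimes> x = e" using m_assoc[OF q(3,1,2)] q(4,7) by simp
        show "x \<otimes> (q \<otimes> e) = e" using m_assoc[OF q(2,3,1)] q(6) ee by simp
      qed (use q in auto)
      moreover have "q \<otimes> e \<otimes> x = e" using m_assoc[OF q(3,1,2)] q(4,7) by simp
      ultimately show ?thesis by blast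
    qed
  qed
qed

text \<open>
  Two powers \<open>a\<^sup>s\<close> and \<open>a\<^sup>t\<close> in group \<open>H\<close>-classes give the same identity, because their common power
  \<open>a\<^sup>s\<^sup>t\<close> is a local unit for both identities.
\<close>

lemma power_idem_eq:
  assumes a: "a \<in> carrier G" and "t \<ge> 1"
    and u: "local_unit G e (a [^] (t::nat))"
  shows "power_idem G a = e"
  unfolding power_idem_def
proof (rule the_equality)
  have "a [^] t \<in> carrier G" using a by simp
  then show "\<exists>t::nat. t \<ge> 1 \<and> group (G\<lparr>carrier := H_class G (a [^] t), one := e\<rparr>)"
    using assms(2) u by (auto simp: group_H_class_iff_local_unit)
next
  fix f assume "\<exists>s::nat. s \<ge> 1 \<and> group (G\<lparr>carrier := H_class G (a [^] s), one := f\<rparr>)"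
  then obtain s :: nat where "s \<ge> 1" "local_unit G f (a [^] s)"
    using a by (auto simp: group_H_class_iff_local_unit)
  then have "local_unit G f (a [^] (s * t))"
    using local_unit_nat_pow[OF _ assms(2), of f "a [^] s"] nat_pow_pow[OF a] by simp
  moreover have "local_unit G e (a [^] (s * t))"
    using local_unit_nat_pow[OF u \<open>s \<ge> 1\<close>] nat_pow_pow[OF a] by (simp add: mult.commute)
  ultimately show "f = e" using local_unit_unique by blast
qed

end

section \<open>Partial maps and their cores\<close>

definition partial_image :: "('v \<rightharpoonup> 'v) \<Rightarrow> 'v set \<Rightarrow> 'v set" where
  "partial_image f U = ran (f |` U)"

lemma mem_partial_image: "y \<in> partial_image f U \<longleftrightarrow> (\<exists>x\<in>U. f x = Some y)"
  unfolding partial_image_def ran_def restrict_map_def by auto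

lemma mono_partial_image: "mono (partial_image f)"
  by (rule monoI) (auto simp: mem_partial_image subset_iff)

lemma partial_image_mono: "U \<subseteq> W \<Longrightarrow> partial_image f U \<subseteq> partial_image f W"
  by (rule monoD[OF mono_partial_image])

lemma partial_image_subset_ran: "partial_image f U \<subseteq> ran f"
  by (auto simp: mem_partial_image ran_def)

lemma partial_image_total [simp]: "partial_image (Some \<circ> F) U = F ` U"
  by (auto simp: mem_partial_image)

lemma pcomp_apply: "pcomp f g x = Option.bind (f x) g"
  by (simp add: pcomp_def map_comp_def split: option.split)

lemma pcomp_assoc: "pcomp (pcomp f g) h = pcomp f (pcomp g h)"
  by (rule ext) (simp add: pcomp_apply[abs_def])

lemma pcomp_Some [simp]: "pcomp f Some = f" "pcomp Some f = f"
  by (simp_all add: fun_eq_iff pcomp_apply)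

lemma pcomp_total [simp]: "pcomp (Some \<circ> F) (Some \<circ> H) = Some \<circ> (H \<circ> F)"
  by (rule ext) (simp add: pcomp_apply)

lemma partial_image_pcomp: "partial_image (pcomp f g) U = partial_image g (partial_image f U)"
  unfolding Set.set_eq_iff Bex_def mem_partial_image pcomp_apply bind_eq_Some_conv by blast

lemma ran_eq_partial_image: "ran f = partial_image f UNIV"
  by (auto simp: mem_partial_image ran_def)

lemma ran_pcomp: "ran (pcomp f g) = partial_image g (ran f)"
  by (simp add: ran_eq_partial_image partial_image_pcomp)

text \<open>
  The greatest fixed point consists of the points that have an infinite backward orbit under \<open>f\<close>.
  Compared with the intersection of the ranges of all powers, it allows coinductive proofs without
  any powers.
\<close>

definition core :: "('v \<rightharpoonup> 'v) \<Rightarrow> 'v set" where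
  "core f = gfp (partial_image f)"

lemma partial_image_core [simp]: "partial_image f (core f) = core f"
  unfolding core_def by (rule gfp_unfold[OF mono_partial_image, symmetric])

lemma core_greatest: "U \<subseteq> partial_image f U \<Longrightarrow> U \<subseteq> core f"
  unfolding core_def by (rule gfp_upperbound)

lemma core_subset_ran: "core f \<subseteq> ran f"
  using partial_image_subset_ran[of f "core f"] by simp

lemma core_eq_ranI:
  assumes "ran f \<subseteq> partial_image f (ran f)"
  shows "core f = ran f"
  by (rule equalityI[OF core_subset_ran core_greatest[OF assms]])

text \<open>
  Precomposition with a map that fixes \<open>ran f\<close> alters \<open>f\<close> only outside \<open>ran f\<close>, whereas a set
  contained in its own image, under \<open>f\<close> or under the composition, lies inside \<open>ran f\<close>.
\<close>

lemma core_precompose: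
  assumes fixes_ran: "\<And>w. w \<in> ran f \<Longrightarrow> P w = w"
  shows "core (pcomp (Some \<circ> P) f) = core f"
proof
  have stays: "P ` U = U" if "U \<subseteq> ran f" for U
  proof -
    have "P ` U = (\<lambda>x. x) ` U" using that by (intro image_cong refl fixes_ran) auto
    then show ?thesis by simp
  qed
  have "partial_image (pcomp (Some \<circ> P) f) (core f) = core f"
    by (simp add: partial_image_pcomp stays[OF core_subset_ran])
  from equalityD2[OF this] show "core f \<subseteq> core (pcomp (Some \<circ> P) f)"
    by (rule core_greatest)
  let ?U = "core (pcomp (Some \<circ> P) f)"
  have U: "?U = partial_image f (P ` ?U)"
    by (rule partial_image_core[of "pcomp (Some \<circ> P) f",
          unfolded partial_image_pcomp partial_image_total, symmetric])
  have "?U \<subseteq> ran f" by (subst U) (rule partial_image_subset_ran)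
  from U[unfolded stays[OF this]] have "?U = partial_image f ?U" .
  from equalityD1[OF this] show "?U \<subseteq> core f" by (rule core_greatest)
qed

section \<open>Partial linear maps of a finite-dimensional space\<close>

context finite_dimensional_vector_space
begin

interpretation endo: finite_dimensional_vector_space_pair scale Basis scale Basis
  by unfold_locales

abbreviation linear_map :: "('b \<Rightarrow> 'b) \<Rightarrow> bool" where
  "linear_map \<equiv> Vector_Spaces.linear scale scale"

lemma linear_map_comp: "linear_map f \<Longrightarrow> linear_map g \<Longrightarrow> linear_map (g \<circ> f)"
  by (rule Vector_Spaces.linear_compose)

lemma ex_projection:
  assumes "subspace W"
  obtains P where "linear_map P" "range P = W" "\<And>w. w \<in> W \<Longrightarrow> P w = w"
proof -
  from endo.linear_exists_left_inverse_on[OF linear_id assms, of] obtain P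
    where P: "range P \<subseteq> W" "linear_map P" "\<forall>w\<in>W. P w = w" by auto
  have "W \<subseteq> range P"
  proof
    fix w assume "w \<in> W"
    then have "w = P w" using P(3) by simp
    then show "w \<in> range P" by blast
  qed
  with P that show thesis by blast
qed

text \<open>
  A linear section of \<open>F\<close> with values in \<open>C\<close> embeds \<open>F ` C\<close> into \<open>C\<close>; by dimension it is onto \<open>C\<close>, so
  \<open>F\<close> is its inverse there.
\<close>

lemma inj_on_if_dim_image_eq:
  assumes F: "linear_map F" and C: "subspace C" and d: "dim (F ` C) = dim C"
  shows "inj_on F C"
proof -
  from endo.linear_exists_right_inverse_on[OF F C] obtain r
    where r: "range r \<subseteq> C" "linear_map r" "\<forall>v\<in>F ` C. F (r v) = v" by auto
  have FC: "subspace (F ` C)" by (rule endo.linear_subspace_image[OF F C])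
  have "inj_on r (F ` C)" using r(3) by (metis inj_onI)
  then have "dim (r ` (F ` C)) = dim (F ` C)"
    by (intro endo.dim_image_eq[OF r(2)]) (simp add: span_eq_iff[THEN iffD2, OF FC])
  then have "r ` (F ` C) = C"
    using d r(1) by (intro subspace_dim_equal endo.linear_subspace_image[OF r(2) FC] C) auto
  then have "\<exists>v\<in>F ` C. c = r v" if "c \<in> C" for c using that by blast
  then show "inj_on F C" using r(3) by (metis inj_onI)
qed

text \<open>
  It suffices to extend \<open>X\<close> from a basis of \<open>C\<close>, whose image is independent, to an injective map on
  the whole space; finite dimension makes this map surjective.
\<close>

lemma extend_to_GL:
  assumes X: "linear_map X" and C: "subspace C" and inj: "inj_on X C"
  obtains g where "g \<in> GL scale" "\<And>c. c \<in> C \<Longrightarrow> g c = X c"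
proof -
  obtain A where A: "A \<subseteq> C" "independent A" "span A = C"
    using basis_subspace_exists[OF C] by metis
  have "independent (X ` A)"
    using A inj by (intro endo.linear_independent_injective_image[OF X]) auto
  moreover have "inj_on X A" using inj A(1) by (rule inj_on_subset)
  ultimately obtain g where g: "linear_map g" "inj g" "\<forall>a\<in>A. g a = X a"
    using linear_independent_extend_inj[OF A(2)] by blast
  have "g c = X c" if "c \<in> C" for c
    using endo.linear_eq_on[OF g(1) X, of c A] that A(3) g(3) by auto
  moreover have "g \<in> GL scale"
    unfolding GL_def using g linear_inj_imp_surj by (auto simp: bij_def)
  ultimately show thesis using that by blast
qed

lemma partial_linear_restrict:
  assumes F: "linear_map F" and D: "subspace D"
  shows "partial_linear scale ((Some \<circ> F) |` D)"
proof -
  have dom: "dom ((Some \<circ> F) |` D) = D" by (auto simp: restrict_map_def dom_def)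
  show ?thesis
    unfolding partial_linear_def dom
    using D by (auto simp: subspace_add subspace_scale endo.linear_add[OF F] endo.linear_scale[OF F])
qed

text \<open>
  Precomposing with a projection onto the domain makes a partial linear map total. This reduces
  statements about partial linear maps to the corresponding ones about linear maps.
\<close>

lemma partial_linear_extend:
  assumes "partial_linear scale f"
  obtains F where "linear_map F" "\<And>x. x \<in> dom f \<Longrightarrow> f x = Some (F x)"
proof -
  have D: "subspace (dom f)"
    and add: "\<And>x y. x \<in> dom f \<Longrightarrow> y \<in> dom f \<Longrightarrow> the (f (x + y)) = the (f x) + the (f y)"
    and sc: "\<And>c x. x \<in> dom f \<Longrightarrow> the (f (scale c x)) = scale c (the (f x))"
    using assms unfolding partial_linear_def by blast+
  obtain P where P: "linear_map P" "range P = dom f" "\<And>w. w \<in> dom f \<Longrightarrow> P w = w"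
    using ex_projection[OF D] by blast
  have in_dom: "P x \<in> dom f" for x using P(2) by blast
  have "linear_map (\<lambda>x. the (f (P x)))"
    unfolding Vector_Spaces.linear_iff
    by (intro conjI allI vector_space_axioms)
      (simp_all add: endo.linear_add[OF P(1)] endo.linear_scale[OF P(1)] add sc in_dom)
  moreover have "f x = Some (the (f (P x)))" if "x \<in> dom f" for x
    using that P(3)[OF that] by auto
  ultimately show thesis by (rule that)
qed

lemma partial_linear_total: "linear_map F \<Longrightarrow> partial_linear scale (Some \<circ> F)"
  using partial_linear_restrict[of F UNIV] by (simp add: restrict_map_def comp_def)

lemma partial_image_extension:
  assumes "\<And>x. x \<in> dom f \<Longrightarrow> f x = Some (F x)"
  shows "partial_image f U = F ` (U \<inter> dom f)"
proof (intro Set.set_eqI iffI)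
  fix y assume "y \<in> partial_image f U"
  then obtain x where x: "x \<in> U" "f x = Some y" by (auto simp: mem_partial_image)
  then show "y \<in> F ` (U \<inter> dom f)" using assms[of x] by (auto simp: dom_def)
next
  fix y assume "y \<in> F ` (U \<inter> dom f)"
  then show "y \<in> partial_image f U" using assms by (auto simp: mem_partial_image)
qed

lemma subspace_dom: "partial_linear scale f \<Longrightarrow> subspace (dom f)"
  by (simp add: partial_linear_def)

lemma partial_linear_pcomp:
  assumes f: "partial_linear scale f" and g: "partial_linear scale g"
  shows "partial_linear scale (pcomp f g)"
proof -
  obtain F where F: "linear_map F" "\<And>x. x \<in> dom f \<Longrightarrow> f x = Some (F x)"
    using partial_linear_extend[OF f] by blast
  obtain H where H: "linear_map H" "\<And>x. x \<in> dom g \<Longrightarrow> g x = Some (H x)"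
    using partial_linear_extend[OF g] by blast
  have "pcomp f g x = ((Some \<circ> (H \<circ> F)) |` (dom f \<inter> F -` dom g)) x" for x
  proof (cases "x \<in> dom f \<and> F x \<in> dom g")
    case True
    then show ?thesis by (simp add: pcomp_apply F(2) H(2))
  next
    case False
    then have "f x = None \<or> (f x = Some (F x) \<and> g (F x) = None)"
      using F(2)[of x] by (cases "x \<in> dom f") (simp_all add: domIff)
    then show ?thesis using False by (auto simp: pcomp_apply restrict_map_def)
  qed
  then have "pcomp f g = (Some \<circ> (H \<circ> F)) |` (dom f \<inter> F -` dom g)" by (rule ext)
  moreover have "subspace (dom f \<inter> F -` dom g)"
    by (intro subspace_inter subspace_dom f endo.linear_subspace_vimage[OF F(1)] g)
  ultimately show ?thesis
    using partial_linear_restrict[OF linear_map_comp[OF F(1) H(1)]] by simp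
qed

lemma subspace_partial_image:
  assumes f: "partial_linear scale f" and U: "subspace U"
  shows "subspace (partial_image f U)"
proof -
  obtain F where F: "linear_map F" "\<And>x. x \<in> dom f \<Longrightarrow> f x = Some (F x)"
    using partial_linear_extend[OF f] by blast
  have img: "partial_image f U = F ` (U \<inter> dom f)" by (rule partial_image_extension[OF F(2)])
  show ?thesis
    unfolding img by (intro endo.linear_subspace_image[OF F(1)] subspace_inter U subspace_dom f)
qed

lemma subspace_ran: "partial_linear scale f \<Longrightarrow> subspace (ran f)"
  unfolding ran_eq_partial_image by (rule subspace_partial_image) simp_all

lemma dim_partial_image_le:
  assumes f: "partial_linear scale f"
  shows "dim (partial_image f U) \<le> dim (U \<inter> dom f)"
proof -
  obtain F where F: "linear_map F" "\<And>x. x \<in> dom f \<Longrightarrow> f x = Some (F x)"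
    using partial_linear_extend[OF f] by blast
  have img: "partial_image f U = F ` (U \<inter> dom f)" by (rule partial_image_extension[OF F(2)])
  show ?thesis
    unfolding img by (rule endo.dim_image_le[OF F(1)])
qed

text \<open>
  If applying a partial linear map to a subspace does not lower the dimension, then no vector of the
  subspace can lie outside the domain, and none but zero can lie in the kernel. The core equals its
  own image, so this applies to it.
\<close>

lemma partial_image_no_loss:
  assumes f: "partial_linear scale f" and U: "subspace U" and d: "dim U \<le> dim (partial_image f U)"
  obtains F where "linear_map F" "inj_on F U" "\<forall>u\<in>U. f u = Some (F u)"
    "F ` U = partial_image f U"
proof -
  obtain F where F: "linear_map F" "\<And>x. x \<in> dom f \<Longrightarrow> f x = Some (F x)"
    using partial_linear_extend[OF f] by blast
  have "U \<inter> dom f = U"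
    using dim_partial_image_le[OF f, of U] d
    by (intro subspace_dim_equal subspace_inter U subspace_dom f) auto
  then have dom: "u \<in> dom f" if "u \<in> U" for u using that by blast
  have img: "F ` U = partial_image f U"
    using partial_image_extension[of f F U, OF F(2)] \<open>U \<inter> dom f = U\<close> by simp
  have "inj_on F U"
    using d endo.dim_image_le[OF F(1), of U] by (intro inj_on_if_dim_image_eq F(1) U) (simp add: img)
  moreover have "\<forall>u\<in>U. f u = Some (F u)"
    using F(2) dom by simp
  ultimately show thesis using that F(1) img by blast
qed

text \<open>The linear span of the core is again contained in its own image, hence in the core.\<close>

lemma subspace_core:
  assumes f: "partial_linear scale f"
  shows "subspace (core f)"
proof -
  have "core f \<subseteq> partial_image f (span (core f))"
    using partial_image_mono[OF span_superset[of "core f"], of f] by simp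
  then have "span (core f) \<subseteq> partial_image f (span (core f))"
    by (intro span_minimal subspace_partial_image f subspace_span)
  then have "span (core f) \<subseteq> core f" by (rule core_greatest)
  then have "span (core f) = core f" by (intro equalityI span_superset)
  with subspace_span[of "core f"] show ?thesis by simp
qed

lemma core_automorphism:
  assumes f: "partial_linear scale f"
  obtains F where "linear_map F" "inj_on F (core f)" "F ` core f = core f"
    "\<forall>c\<in>core f. f c = Some (F c)"
  by (rule partial_image_no_loss[OF f subspace_core[OF f], unfolded partial_image_core, OF order_refl])
    (rule that)

lemma core_subset_dom: "partial_linear scale f \<Longrightarrow> core f \<subseteq> dom f"
  by (rule core_automorphism) auto

lemma restrict_core_in_PAut:
  assumes f: "partial_linear scale f"
  shows "f |` core f \<in> PAut scale"
proof -
  obtain F where F: "linear_map F" "inj_on F (core f)" "F ` core f = core f"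
    "\<forall>c\<in>core f. f c = Some (F c)"
    by (rule core_automorphism[OF f])
  have eq: "f |` core f = (Some \<circ> F) |` core f"
    by (rule ext) (simp add: restrict_map_def F(4))
  have "dom (f |` core f) = core f" unfolding eq by (auto simp: restrict_map_def dom_def)
  moreover have "ran (f |` core f) = core f" by (simp flip: partial_image_def)
  moreover have "inj_on (f |` core f) (core f)"
    using F(2) by (auto simp: inj_on_def F(4))
  ultimately show ?thesis
    unfolding PAut_def using partial_linear_restrict[OF F(1) subspace_core[OF f]] subspace_core[OF f]
    by (simp add: eq)
qed

section \<open>Conjugacy by the general linear group\<close>

lemma GL_D:
  assumes "g \<in> GL scale"
  shows "linear_map g" "bij g" "linear_map (inv_into UNIV g)"
    "inv_into UNIV g (g v) = v" "g (inv_into UNIV g v) = v"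
  using assms inj_linear_imp_inv_linear[of g]
  by (auto simp: GL_def bij_is_inj bij_is_surj inv_f_f surj_f_inv_f)

lemma GL_conjugate_trans:
  assumes "GL_conjugate scale a b" "GL_conjugate scale b c"
  shows "GL_conjugate scale a c"
proof -
  obtain g where g: "g \<in> GL scale" "a = pcomp (pcomp (Some \<circ> inv_into UNIV g) b) (Some \<circ> g)"
    using assms(1) unfolding GL_conjugate_def by blast
  obtain h where h: "h \<in> GL scale" "b = pcomp (pcomp (Some \<circ> inv_into UNIV h) c) (Some \<circ> h)"
    using assms(2) unfolding GL_conjugate_def by blast
  have "g \<circ> h \<in> GL scale"
    unfolding GL_def mem_Collect_eq
    by (intro conjI linear_map_comp bij_comp GL_D[OF g(1)] GL_D[OF h(1)])
  moreover have "a = pcomp (pcomp (Some \<circ> inv_into UNIV (g \<circ> h)) c) (Some \<circ> (g \<circ> h))"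
    unfolding g(2) h(2) o_inv_distrib[OF GL_D(2)[OF g(1)] GL_D(2)[OF h(1)]]
    by (simp only: pcomp_total[symmetric] pcomp_assoc)
  ultimately have "\<exists>g\<in>GL scale. a = pcomp (pcomp (Some \<circ> inv_into UNIV g) c) (Some \<circ> g)"
    by (intro bexI)
  moreover have "a \<in> PAut scale" "c \<in> PAut scale"
    using assms unfolding GL_conjugate_def by simp_all
  ultimately show ?thesis unfolding GL_conjugate_def by simp
qed

text \<open>
  Unfolds conjugacy into a form without inverses or restrictions: \<open>g\<close> carries one core to the other
  and intertwines the two maps on it.
\<close>

lemma GL_conjugate_core_iff:
  assumes f: "partial_linear scale f" and h: "partial_linear scale h"
  shows "GL_conjugate scale (f |` core f) (h |` core h) \<longleftrightarrow>
    (\<exists>g\<in>GL scale. g ` core h = core f \<and> (\<forall>c\<in>core h. f (g c) = map_option g (h c)))"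
proof -
  have "f |` core f = pcomp (pcomp (Some \<circ> inv_into UNIV g) (h |` core h)) (Some \<circ> g) \<longleftrightarrow>
      g ` core h = core f \<and> (\<forall>c\<in>core h. f (g c) = map_option g (h c))" (is "?L \<longleftrightarrow> ?R")
    if g: "g \<in> GL scale" for g
  proof -
    note [simp] = GL_D(4,5)[OF g]
    have conj: "pcomp (pcomp (Some \<circ> inv_into UNIV g) (h |` core h)) (Some \<circ> g) x
        = map_option g ((h |` core h) (inv_into UNIV g x))" for x
      by (cases "(h |` core h) (inv_into UNIV g x)") (simp_all add: pcomp_apply)
    have "?L \<longleftrightarrow> (\<forall>x. (f |` core f) x = map_option g ((h |` core h) (inv_into UNIV g x)))"
      by (simp add: fun_eq_iff conj)
    also have "\<dots> \<longleftrightarrow> (\<forall>y. (f |` core f) (g y) = map_option g ((h |` core h) y))"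
    proof (intro iffI allI)
      fix y assume "\<forall>x. (f |` core f) x = map_option g ((h |` core h) (inv_into UNIV g x))"
      from this[rule_format, of "g y"] show "(f |` core f) (g y) = map_option g ((h |` core h) y)"
        by simp
    next
      fix x assume "\<forall>y. (f |` core f) (g y) = map_option g ((h |` core h) y)"
      from this[rule_format, of "inv_into UNIV g x"]
      show "(f |` core f) x = map_option g ((h |` core h) (inv_into UNIV g x))" by simp
    qed
    also have "\<dots> \<longleftrightarrow> ?R"
    proof (intro iffI conjI allI ballI)
      assume *: "\<forall>y. (f |` core f) (g y) = map_option g ((h |` core h) y)"
      have iff: "g y \<in> core f \<longleftrightarrow> y \<in> core h" for y
      proof -
        have "g y \<in> core f \<longleftrightarrow> (f |` core f) (g y) \<noteq> None"
          using core_subset_dom[OF f] by (auto simp: restrict_map_def)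
        also have "\<dots> \<longleftrightarrow> (h |` core h) y \<noteq> None"
          by (simp add: *)
        also have "\<dots> \<longleftrightarrow> y \<in> core h"
          using core_subset_dom[OF h] by (auto simp: restrict_map_def)
        finally show ?thesis .
      qed
      show "g ` core h = core f"
      proof (intro equalityI subsetI)
        fix x assume "x \<in> core f"
        then have "inv_into UNIV g x \<in> core h" "x = g (inv_into UNIV g x)"
          using iff[of "inv_into UNIV g x"] by simp_all
        then show "x \<in> g ` core h" by blast
      next
        fix x assume "x \<in> g ` core h"
        then show "x \<in> core f" using iff by (elim imageE) simp
      qed
      fix c assume c: "c \<in> core h"
      show "f (g c) = map_option g (h c)" using *[rule_format, of c] c iff[of c] by simp
    next
      fix y assume R: ?R
      show "(f |` core f) (g y) = map_option g ((h |` core h) y)"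
      proof (cases "y \<in> core h")
        case True
        with R have "g y \<in> core f" by blast
        then show ?thesis using True R by simp
      next
        case False
        have "g y \<notin> core f"
        proof
          assume "g y \<in> core f"
          then obtain c where c: "c \<in> core h" "g y = g c" using R by blast
          then have "inv_into UNIV g (g y) = inv_into UNIV g (g c)" by simp
          then have "y = c" by (simp only: GL_D(4)[OF g])
          with c(1) False show False by simp
        qed
        then show ?thesis using False by simp
      qed
    qed
    finally show ?thesis .
  qed
  then show ?thesis
    unfolding GL_conjugate_def by (simp add: restrict_core_in_PAut f h cong: bex_cong)
qed

section \<open>The cores of a product and of the swapped product\<close>

text \<open>
  The image of \<open>core (x y)\<close> under \<open>x\<close> is mapped by \<open>y\<close> onto \<open>core (x y)\<close> and from there by \<open>x\<close> back
  onto itself. So it is fixed by \<open>y x\<close>.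
\<close>

lemma partial_image_core_pcomp:
  "partial_image x (core (pcomp x y)) \<subseteq> core (pcomp y x)"
  "partial_image y (partial_image x (core (pcomp x y))) = core (pcomp x y)"
proof -
  show *: "partial_image y (partial_image x (core (pcomp x y))) = core (pcomp x y)"
    by (simp flip: partial_image_pcomp)
  have "partial_image (pcomp y x) (partial_image x (core (pcomp x y)))
      = partial_image x (core (pcomp x y))"
    unfolding partial_image_pcomp[of y x] * ..
  from equalityD2[OF this] show "partial_image x (core (pcomp x y)) \<subseteq> core (pcomp y x)"
    by (rule core_greatest)
qed

lemma dim_core_pcomp_le:
  assumes x: "partial_linear scale x" and y: "partial_linear scale y"
  shows "dim (core (pcomp x y)) \<le> dim (partial_image x (core (pcomp x y)))"
    and "dim (partial_image x (core (pcomp x y))) \<le> dim (core (pcomp y x))"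
proof -
  have "dim (core (pcomp x y)) = dim (partial_image y (partial_image x (core (pcomp x y))))"
    by (simp only: partial_image_core_pcomp(2))
  also have "\<dots> \<le> dim (partial_image x (core (pcomp x y)) \<inter> dom y)"
    by (rule dim_partial_image_le[OF y])
  also have "\<dots> \<le> dim (partial_image x (core (pcomp x y)))"
    by (rule dim_subset) blast
  finally show "dim (core (pcomp x y)) \<le> dim (partial_image x (core (pcomp x y)))" .
  show "dim (partial_image x (core (pcomp x y))) \<le> dim (core (pcomp y x))"
    by (rule dim_subset[OF partial_image_core_pcomp(1)])
qed

text \<open>
  By the dimension bounds in both directions the two cores have equal dimension, so \<open>x\<close> restricts to
  an isomorphism between them. It intertwines the products because \<open>(x y) x = x (y x)\<close>.
\<close>

lemma swap_imp_GL_conjugate: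
  assumes x: "partial_linear scale x" and y: "partial_linear scale y"
  shows "GL_conjugate scale (pcomp y x |` core (pcomp y x)) (pcomp x y |` core (pcomp x y))"
proof -
  let ?f = "pcomp x y" and ?h = "pcomp y x"
  have f: "partial_linear scale ?f" and h: "partial_linear scale ?h"
    by (intro partial_linear_pcomp x y)+
  have "dim (core ?h) \<le> dim (partial_image x (core ?f))"
    using dim_core_pcomp_le[OF x y] dim_core_pcomp_le[OF y x] by linarith
  then have img: "partial_image x (core ?f) = core ?h"
    by (intro subspace_dim_equal subspace_partial_image subspace_core x f h
        partial_image_core_pcomp)
  obtain X where X: "linear_map X" "inj_on X (core ?f)" "\<forall>c\<in>core ?f. x c = Some (X c)"
      "X ` core ?f = core ?h"
    by (rule partial_image_no_loss[OF x subspace_core[OF f] dim_core_pcomp_le(1)[OF x y],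
          unfolded img])
  obtain g where g: "g \<in> GL scale" "\<And>c. c \<in> core ?f \<Longrightarrow> g c = X c"
    using extend_to_GL[OF X(1) subspace_core[OF f] X(2)] by blast
  obtain F where F: "linear_map F" "inj_on F (core ?f)" "F ` core ?f = core ?f"
      "\<forall>c\<in>core ?f. ?f c = Some (F c)"
    by (rule core_automorphism[OF f])
  have "?h (g c) = map_option g (?f c)" if c: "c \<in> core ?f" for c
  proof -
    have d: "F c \<in> core ?f" using imageI[OF c, of F] by (simp only: F(3))
    have fc: "?f c = Some (F c)" using F(4) c by blast
    then have "y (X c) = Some (F c)" using X(3) c by (simp add: pcomp_apply)
    then have "?h (X c) = Some (X (F c))" using X(3) d by (simp add: pcomp_apply)
    then show ?thesis by (simp add: fc g(2)[OF c] g(2)[OF d])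
  qed
  moreover have "g ` core ?f = core ?h" using X(4) g(2) by (metis image_cong)
  ultimately show ?thesis
    unfolding GL_conjugate_core_iff[OF h f] using g(1) by blast
qed

section \<open>The semigroups of total and of partial endomorphisms\<close>

context
  fixes S :: "('b \<rightharpoonup> 'b) monoid"
  assumes S: "S = End scale \<or> S = PEnd scale"
begin

lemma mult_S: "mult S = pcomp" and one_S: "one S = Some"
  using S by (auto simp: End_def PEnd_def)

lemma carrier_S_partial_linear: "f \<in> carrier S \<Longrightarrow> partial_linear scale f"
  using S partial_linear_total by (auto simp: End_def PEnd_def)

lemma total_in_carrier_S: "linear_map F \<Longrightarrow> Some \<circ> F \<in> carrier S"
  using S partial_linear_total by (auto simp: End_def PEnd_def)

lemma pcomp_in_carrier_S:
  assumes "f \<in> carrier S" "g \<in> carrier S"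
  shows "pcomp f g \<in> carrier S"
  using S
proof
  assume E: "S = End scale"
  then obtain F H where "linear_map F" "linear_map H" "f = Some \<circ> F" "g = Some \<circ> H"
    using assms by (auto simp: End_def)
  then show ?thesis using total_in_carrier_S[OF linear_map_comp] by simp
next
  assume "S = PEnd scale"
  then show ?thesis using assms partial_linear_pcomp by (simp add: PEnd_def)
qed

lemma monoid_S: "monoid S"
proof (rule monoidI)
  show "\<one>\<^bsub>S\<^esub> \<in> carrier S" using total_in_carrier_S[OF linear_id] by (simp add: one_S comp_def)
qed (simp_all add: mult_S one_S pcomp_in_carrier_S pcomp_assoc)

lemma p_related_sym: "p_related S a b \<Longrightarrow> p_related S b a"
  unfolding p_related_def by blast

lemma semigroup_conjugate_sym: "semigroup_conjugate S a b \<Longrightarrow> semigroup_conjugate S b a"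
  unfolding semigroup_conjugate_def
proof (induction rule: tranclp_induct)
  case (base y)
  show ?case by (rule tranclp.r_into_trancl, rule p_related_sym, rule base)
next
  case (step y z)
  from step.hyps(2) have "p_related S z y" by (rule p_related_sym)
  then show ?case using step.IH by (rule tranclp_into_tranclp2)
qed

lemma semigroup_conjugate_trans:
  "semigroup_conjugate S a b \<Longrightarrow> semigroup_conjugate S b c \<Longrightarrow> semigroup_conjugate S a c"
  unfolding semigroup_conjugate_def by (rule tranclp_trans)

lemma p_related_imp_semigroup_conjugate: "p_related S a b \<Longrightarrow> semigroup_conjugate S a b"
  unfolding semigroup_conjugate_def by (rule tranclp.r_into_trancl)

lemma p_related_imp_GL_conjugate:
  assumes "p_related S a b"
  shows "GL_conjugate scale (a |` core a) (b |` core b)"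
proof -
  from assms obtain x y where "x \<in> carrier S" "y \<in> carrier S" "a = pcomp x y" "b = pcomp y x"
    unfolding p_related_def mult_S by blast
  then show ?thesis by (simp add: swap_imp_GL_conjugate carrier_S_partial_linear)
qed

lemma semigroup_conjugate_imp_GL_conjugate:
  assumes "semigroup_conjugate S a b"
  shows "GL_conjugate scale (a |` core a) (b |` core b)"
  using assms unfolding semigroup_conjugate_def
proof (induction rule: tranclp_induct)
  case (base y)
  then show ?case by (rule p_related_imp_GL_conjugate)
next
  case (step y z)
  show ?case by (rule GL_conjugate_trans[OF step.IH p_related_imp_GL_conjugate[OF step.hyps(2)]])
qed

text \<open>Write \<open>f = f Q\<close> and swap the factors.\<close>

lemma p_related_precompose:
  assumes f: "f \<in> carrier S" and Q: "linear_map Q" "\<And>w. w \<in> ran f \<Longrightarrow> Q w = w"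
  shows "p_related S f (pcomp (Some \<circ> Q) f)"
proof -
  have "f x = pcomp f (Some \<circ> Q) x" for x
    by (cases "f x") (simp_all add: pcomp_apply Q(2) ranI)
  then have "f = pcomp f (Some \<circ> Q)" by (rule ext)
  then show ?thesis
    unfolding p_related_def mult_S
    by (intro bexI[of _ f] bexI[of _ "Some \<circ> Q"] conjI refl f total_in_carrier_S[OF Q(1)])
qed

text \<open>
  Induction on the rank. As long as the range of \<open>f\<close> exceeds the core, passing to \<open>Q f\<close> with a
  projection \<open>Q\<close> onto \<open>ran f\<close> lowers the rank, and it neither affects the core nor the goal \<open>P f\<close>.
  Once range and core coincide, \<open>P\<close> itself can be taken for \<open>Q\<close>.
\<close>

lemma semigroup_conjugate_collapse:
  assumes "f \<in> carrier S" and P: "linear_map P" "range P = core f" "\<And>c. c \<in> core f \<Longrightarrow> P c = c"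
  shows "semigroup_conjugate S f (pcomp (Some \<circ> P) f)"
  using assms
proof (induction "dim (ran f)" arbitrary: f rule: less_induct)
  case less
  have f: "partial_linear scale f" by (rule carrier_S_partial_linear[OF less.prems(1)])
  show ?case
  proof (cases "ran f \<subseteq> core f")
    case True
    then have P_ran: "P w = w" if "w \<in> ran f" for w using less.prems(4) that by blast
    show ?thesis
      by (rule p_related_imp_semigroup_conjugate[OF p_related_precompose[OF less.prems(1,2) P_ran]])
  next
    case False
    obtain Q where Q: "linear_map Q" "range Q = ran f" "\<And>w. w \<in> ran f \<Longrightarrow> Q w = w"
      using ex_projection[OF subspace_ran[OF f]] by blast
    let ?f = "pcomp (Some \<circ> Q) f"
    have f': "?f \<in> carrier S"
      by (intro pcomp_in_carrier_S total_in_carrier_S Q less.prems)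
    have core: "core ?f = core f" by (rule core_precompose[OF Q(3)])
    have ran': "ran ?f = partial_image f (ran f)"
      unfolding ran_pcomp ran_eq_partial_image[of "Some \<circ> Q"] by (simp add: Q(2))
    have "dim (ran ?f) < dim (ran f)"
    proof (rule ccontr)
      assume "\<not> dim (ran ?f) < dim (ran f)"
      then have "ran ?f = ran f"
        unfolding ran' by (intro subspace_dim_equal subspace_partial_image subspace_ran f
            partial_image_subset_ran) simp
      then have "core f = ran f" unfolding ran' by (intro core_eq_ranI) simp
      with False show False by simp
    qed
    from less.hyps[OF this f', unfolded core, OF less.prems(2-4)]
    have "semigroup_conjugate S ?f (pcomp (Some \<circ> P) ?f)" .
    moreover have "pcomp (Some \<circ> P) ?f = pcomp (Some \<circ> P) f"
    proof -
      have "P v \<in> ran f" for v using less.prems(3) core_subset_ran[of f] by blast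
      then have "Q \<circ> P = P" by (simp add: fun_eq_iff Q(3))
      then show ?thesis by (simp flip: pcomp_assoc)
    qed
    moreover have "semigroup_conjugate S f ?f"
      by (rule p_related_imp_semigroup_conjugate[OF p_related_precompose[OF less.prems(1) Q(1,3)]])
    ultimately show ?thesis using semigroup_conjugate_trans[of f ?f] by simp
  qed
qed

text \<open>
  Collapse both maps, using a projection \<open>P\<close> onto \<open>core h\<close> and the corresponding projection
  \<open>R = g P g\<^sup>-\<^sup>1\<close> (applied from right to left) onto \<open>core f\<close>. The collapsed maps are conjugate by \<open>g\<close>
  on the whole space, which makes them \<open>p\<close>-related.
\<close>

lemma GL_conjugate_imp_semigroup_conjugate:
  assumes f: "f \<in> carrier S" and h: "h \<in> carrier S"
    and conj: "GL_conjugate scale (f |` core f) (h |` core h)"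
  shows "semigroup_conjugate S f h"
proof -
  note fl = carrier_S_partial_linear[OF f] and hl = carrier_S_partial_linear[OF h]
  obtain g where g: "g \<in> GL scale" "g ` core h = core f"
      "\<And>c. c \<in> core h \<Longrightarrow> f (g c) = map_option g (h c)"
    using conj unfolding GL_conjugate_core_iff[OF fl hl] by blast
  note [simp] = GL_D(4,5)[OF g(1)]
  obtain P where P: "linear_map P" "range P = core h" "\<And>c. c \<in> core h \<Longrightarrow> P c = c"
    using ex_projection[OF subspace_core[OF hl]] by blast
  define R where "R = g \<circ> (P \<circ> inv_into UNIV g)"
  have R: "linear_map R"
    unfolding R_def by (intro linear_map_comp GL_D[OF g(1)] P(1))
  have "range (inv_into UNIV g) = UNIV" using GL_D(2)[OF g(1)] by (intro bij_is_surj bij_imp_bij_inv)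
  then have ranR: "range R = core f"
    unfolding R_def image_comp[symmetric] by (simp add: P(2) g(2))
  have idR: "R c = c" if "c \<in> core f" for c
  proof -
    from that g(2) obtain d where "d \<in> core h" "c = g d" by blast
    then show ?thesis by (simp add: R_def P(3))
  qed
  let ?f = "pcomp (Some \<circ> R) f" and ?h = "pcomp (Some \<circ> P) h"
  have "p_related S ?f ?h"
    unfolding p_related_def mult_S
  proof (intro bexI conjI)
    show "?f = pcomp (pcomp (Some \<circ> inv_into UNIV g) ?h) (Some \<circ> g)"
    proof
      fix v
      have "P (inv_into UNIV g v) \<in> core h" using P(2) by blast
      from g(3)[OF this] show "?f v = pcomp (pcomp (Some \<circ> inv_into UNIV g) ?h) (Some \<circ> g) v"
        by (cases "h (P (inv_into UNIV g v))") (simp_all add: pcomp_apply R_def)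
    qed
    show "?h = pcomp (Some \<circ> g) (pcomp (Some \<circ> inv_into UNIV g) ?h)"
      by (rule ext) (simp add: pcomp_apply)
    show "Some \<circ> g \<in> carrier S" by (rule total_in_carrier_S[OF GL_D(1)[OF g(1)]])
    show "pcomp (Some \<circ> inv_into UNIV g) ?h \<in> carrier S"
      by (intro pcomp_in_carrier_S total_in_carrier_S GL_D(3)[OF g(1)] P(1) h)
  qed
  then have fh: "semigroup_conjugate S ?f ?h" by (rule p_related_imp_semigroup_conjugate)
  have "semigroup_conjugate S f ?f"
    by (rule semigroup_conjugate_collapse[OF f R ranR idR])
  then have "semigroup_conjugate S f ?h" using fh by (rule semigroup_conjugate_trans)
  moreover have "semigroup_conjugate S ?h h"
    by (rule semigroup_conjugate_sym[OF semigroup_conjugate_collapse[OF h P]])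
  ultimately show ?thesis by (rule semigroup_conjugate_trans)
qed

section \<open>The group part of an endomorphism\<close>

lemma partial_image_nat_pow_core: "partial_image (f [^]\<^bsub>S\<^esub> (k::nat)) (core f) = core f"
proof (induction k)
  interpret monoid S by (rule monoid_S)
  {
    case 0
    show ?case by (auto simp: one_S mem_partial_image)
  next
    case (Suc k)
    then show ?case by (simp add: mult_S partial_image_pcomp)
  }
qed

text \<open>
  Choose a power \<open>p\<close> of minimal rank. Then one more application of \<open>f\<close> cannot shrink \<open>ran p\<close>, so
  \<open>ran p\<close> is contained in the core.
\<close>

lemma ex_power_with_ran_core:
  assumes f: "f \<in> carrier S"
  obtains t :: nat where "t \<ge> 1" "ran (f [^]\<^bsub>S\<^esub> t) = core f"
proof -
  interpret monoid S by (rule monoid_S)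
  obtain t :: nat where t: "t \<ge> 1"
    and min: "\<forall>s::nat. s \<ge> 1 \<longrightarrow> dim (ran (f [^]\<^bsub>S\<^esub> t)) \<le> dim (ran (f [^]\<^bsub>S\<^esub> s))"
    using ex_has_least_nat[of "\<lambda>s::nat. s \<ge> 1" 1 "\<lambda>s. dim (ran (f [^]\<^bsub>S\<^esub> s))", OF order_refl]
    by (elim exE conjE) (rule that)
  let ?p = "f [^]\<^bsub>S\<^esub> t"
  have p: "partial_linear scale ?p" by (intro carrier_S_partial_linear nat_pow_closed f)
  have "ran (f [^]\<^bsub>S\<^esub> Suc t) = partial_image f (ran ?p)"
    unfolding nat_pow_Suc mult_S by (rule ran_pcomp)
  moreover have "ran (f [^]\<^bsub>S\<^esub> Suc t) = ran ?p"
  proof (rule subspace_dim_equal)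
    show "ran (f [^]\<^bsub>S\<^esub> Suc t) \<subseteq> ran ?p"
      unfolding nat_pow_Suc2[OF f] mult_S ran_pcomp by (rule partial_image_subset_ran)
    show "dim (ran ?p) \<le> dim (ran (f [^]\<^bsub>S\<^esub> Suc t))" by (rule min[rule_format]) simp
  qed (intro subspace_ran carrier_S_partial_linear nat_pow_closed f)+
  ultimately have "partial_image f (ran ?p) = ran ?p" by (rule trans[OF sym])
  from equalityD2[OF this] have "ran ?p \<subseteq> core f" by (rule core_greatest)
  moreover have "core f \<subseteq> ran ?p"
    using partial_image_subset_ran[of ?p "core f"] by (simp add: partial_image_nat_pow_core)
  ultimately show thesis by (intro that[OF t] equalityI)
qed

text \<open>
  With \<open>p = f\<^sup>t\<close> of range \<open>core f\<close> and \<open>r\<close> inverting \<open>p\<close> on the core, the identity of the group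
  \<open>H\<close>-class of \<open>p\<close> is \<open>e = p r\<close>, and \<open>q = p r r\<close> is an inverse of \<open>p\<close> with respect to \<open>e\<close>.
  Choosing \<open>r\<close> total keeps these elements in \<open>S\<close> for both semigroups.
\<close>

lemma ran_restrict_power_idem:
  assumes f: "f \<in> carrier S"
  shows "ran_restrict (f \<otimes>\<^bsub>S\<^esub> power_idem S f) = f |` core f"
proof -
  interpret monoid S by (rule monoid_S)
  obtain t :: nat where t: "t \<ge> 1" and ran_p: "ran (f [^]\<^bsub>S\<^esub> t) = core f"
    using ex_power_with_ran_core[OF f] by blast
  define p where "p = f [^]\<^bsub>S\<^esub> t"
  define C where "C = core f"
  have pS: "p \<in> carrier S" unfolding p_def using f by (rule nat_pow_closed)
  have p: "partial_linear scale p" using pS by (rule carrier_S_partial_linear)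
  have p_in_C: "y \<in> C" if "p x = Some y" for x y
    using ranI[of p x y] that ran_p by (simp add: p_def C_def)
  have "core p = ran p"
    by (rule core_eq_ranI) (simp add: p_def ran_p partial_image_nat_pow_core)
  then have core_p: "core p = C" by (simp add: p_def C_def ran_p)
  obtain F where F: "linear_map F" "inj_on F C" "F ` C = C" "\<forall>c\<in>C. p c = Some (F c)"
    by (rule core_automorphism[OF p, unfolded core_p])
  note p_on_C = F(4)[THEN bspec]
  have C: "subspace C" using subspace_core[OF p] by (simp add: core_p)
  obtain r where r: "range r \<subseteq> C" "linear_map r" "\<And>c. c \<in> C \<Longrightarrow> r (F c) = c"
    using endo.linear_exists_left_inverse_on[OF F(1) C F(2)] by blast
  have r_C: "r v \<in> C" for v using r(1) by blast
  have Fr: "F (r c) = c" if "c \<in> C" for c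
  proof -
    from that have "c \<in> F ` C" by (simp only: F(3))
    then show ?thesis by (elim imageE) (simp add: r(3))
  qed
  define \<rho> where "\<rho> = Some \<circ> r"
  define e where "e = pcomp p \<rho>"
  have \<rho>: "\<rho> \<in> carrier S" unfolding \<rho>_def by (rule total_in_carrier_S[OF r(2)])
  have e_Some: "e x = Some (r y)" if "p x = Some y" for x y
    using that by (simp add: e_def \<rho>_def pcomp_apply)
  have e_None: "e x = None" if "p x = None" for x
    using that by (simp add: e_def pcomp_apply)
  have "local_unit S e p"
    unfolding local_unit_def mult_S
  proof (intro conjI bexI)
    show eS: "e \<in> carrier S" unfolding e_def by (intro pcomp_in_carrier_S pS \<rho>)
    show "pcomp e \<rho> \<in> carrier S" by (intro pcomp_in_carrier_S eS \<rho>)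
    show "p \<in> carrier S" by (rule pS)
    show "pcomp e p = p"
    proof
      fix x show "pcomp e p x = p x"
        by (cases "p x")
          (simp_all add: pcomp_apply e_Some e_None p_on_C r_C Fr p_in_C)
    qed
    show "pcomp p e = p"
    proof
      fix x show "pcomp p e x = p x"
        by (cases "p x")
          (simp_all add: pcomp_apply e_Some[OF p_on_C] r(3) p_in_C)
    qed
    show "pcomp p (pcomp e \<rho>) = e"
    proof
      fix x show "pcomp p (pcomp e \<rho>) x = e x"
        by (cases "p x")
          (simp_all add: pcomp_apply e_Some e_None e_Some[OF p_on_C] r(3) p_in_C \<rho>_def)
    qed
    show "pcomp (pcomp e \<rho>) p = e"
    proof
      fix x show "pcomp (pcomp e \<rho>) p x = e x"
        by (cases "p x")
          (simp_all add: pcomp_apply e_Some e_None p_on_C r_C Fr \<rho>_def)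
    qed
  qed
  then have idem: "power_idem S f = e"
    unfolding p_def by (intro power_idem_eq[OF f t])
  \<comment> \<open>The range of \<open>f e = f\<^sup>t\<^sup>+\<^sup>1 r\<close> is again the core.\<close>
  have "ran (pcomp f e) = r ` partial_image p (ran f)"
    unfolding e_def \<rho>_def pcomp_assoc[symmetric] ran_pcomp by simp
  also have "partial_image p (ran f) = ran (f [^]\<^bsub>S\<^esub> Suc t)"
    unfolding nat_pow_Suc2[OF f] mult_S ran_pcomp p_def ..
  also have "\<dots> = C"
    unfolding nat_pow_Suc mult_S ran_pcomp ran_p by (simp add: C_def)
  also have "r ` C = C"
  proof (intro equalityI subsetI)
    fix c assume "c \<in> r ` C"
    then show "c \<in> C" by (elim imageE) (simp add: r_C)
  next
    fix c assume c: "c \<in> C"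
    have "F c \<in> C" using imageI[OF c, of F] by (simp only: F(3))
    from imageI[OF this, of r] show "c \<in> r ` C" by (simp only: r(3)[OF c])
  qed
  finally have ran: "ran (pcomp f e) = C" .
  obtain H where H: "linear_map H" "inj_on H C" "H ` C = C" "\<forall>c\<in>C. f c = Some (H c)"
    by (rule core_automorphism[OF carrier_S_partial_linear[OF f], folded C_def])
  have "pcomp f e c = f c" if c: "c \<in> C" for c
  proof -
    have "H c \<in> C" using imageI[OF c, of H] by (simp only: H(3))
    then show ?thesis using H(4) c by (simp add: pcomp_apply e_Some[OF p_on_C] r(3))
  qed
  then have "pcomp f e |` C = f |` C" by (auto simp: restrict_map_def)
  then show ?thesis
    unfolding ran_restrict_def idem mult_S ran by (simp add: C_def)
qed

end

end

theorem theorem7: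
  fixes scale :: "'f::field \<Rightarrow> 'v::ab_group_add \<Rightarrow> 'v"
    and B :: "'v set" and n :: nat
    and S :: "('v \<rightharpoonup> 'v) monoid"
    and \<phi> \<psi> :: "'v \<rightharpoonup> 'v"
  assumes "finite_dimensional_vector_space scale B"
    and "vector_space.dim scale (UNIV :: 'v set) = n"
    and "S = End scale \<or> S = PEnd scale"
    and "\<phi> \<in> carrier S" and "\<psi> \<in> carrier S"
  shows "semigroup_conjugate S \<phi> \<psi> \<longleftrightarrow>
    GL_conjugate scale
      (ran_restrict (\<phi> \<otimes>\<^bsub>S\<^esub> power_idem S \<phi>))
      (ran_restrict (\<psi> \<otimes>\<^bsub>S\<^esub> power_idem S \<psi>))"
proof -
  interpret finite_dimensional_vector_space scale B by (rule assms(1))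
  show ?thesis
    unfolding ran_restrict_power_idem[OF assms(3,4)] ran_restrict_power_idem[OF assms(3,5)]
    using semigroup_conjugate_imp_GL_conjugate[OF assms(3)]
      GL_conjugate_imp_semigroup_conjugate[OF assms(3-5)] by blast
qed

end
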